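(* Let $(S,+,\circ)$ be a dual weak brace. Then $\mathcal{D}_r(S)$ is a full inverse subsemigroup of the Clifford semigroup $(S,\circ)$ containing the center $\zeta(S,\circ)$ of $(S,\circ)$.
   Context: An inverse semigroup is a semigroup in which every element $a$ has a unique inverse $a'$ satisfying $a=aa'a$ and $a'=a'aa'$; it is a Clifford semigroup if moreover $aa'=a'a$ for every $a$. A weak (left) brace $(S,+,\circ)$ is a set $S$ with two binary operations such that $(S,+)$ and $(S,\circ)$ are inverse semigroups and, for all $a,b,c\in S$, $a\circ(b+c)=a\circ b-a+a\circ c$ and $a\circ a^-=-a+a$, where $-a$ and $a^-$ denote the inverses of $a$ in $(S,+)$ and $(S,\circ)$, respectively. The operation $+$ need not be commutative; $\circ$ binds more tightly than $+$ and $-$, and $x-y$ means $x+(-y)$. A weak brace is a dual weak brace if $(S,\circ)$ is a Clifford semigroup. The (right) distributor of $S$ is $\mathcal{D}_r(S)=\{z\in S\mid \forall a,b\in S\ \ (a+b)\circ z=a\circ z-z+b\circ z\}$. An inverse subsemigroup of an inverse semigroup is a subsemigroup closed under taking inverses; it is full if it contains all idempotents. The center is $\zeta(S,\circ)=\{z\in S\mid \forall a\in S\ \ z\circ a=a\circ z\}$. *)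

theory Defs
  imports Main
begin

definition inverse_elt_of :: "'a set \<Rightarrow> ('a \<Rightarrow> 'a \<Rightarrow> 'a) \<Rightarrow> 'a \<Rightarrow> 'a \<Rightarrow> bool" where
  "inverse_elt_of S f a a' \<longleftrightarrow> a' \<in> S \<and> a = f (f a a') a \<and> a' = f (f a' a) a'"

locale semigroup_on =
  fixes S :: "'a set" and f :: "'a \<Rightarrow> 'a \<Rightarrow> 'a"
  assumes closed: "\<lbrakk>a \<in> S; b \<in> S\<rbrakk> \<Longrightarrow> f a b \<in> S"
    and assoc: "\<lbrakk>a \<in> S; b \<in> S; c \<in> S\<rbrakk> \<Longrightarrow> f (f a b) c = f a (f b c)"

locale inverse_semigroup = semigroup_on S f
  for S :: "'a set" and f :: "'a \<Rightarrow> 'a \<Rightarrow> 'a" +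
  assumes unique_inverse: "a \<in> S \<Longrightarrow> \<exists>!a'. inverse_elt_of S f a a'"

text \<open>Only meaningful for \<open>a \<in> S\<close> with \<open>(S, f)\<close> an inverse semigroup.\<close>

definition inverse_elt :: "'a set \<Rightarrow> ('a \<Rightarrow> 'a \<Rightarrow> 'a) \<Rightarrow> 'a \<Rightarrow> 'a" where
  "inverse_elt S f a = (THE a'. inverse_elt_of S f a a')"

locale clifford_semigroup = inverse_semigroup S f
  for S :: "'a set" and f :: "'a \<Rightarrow> 'a \<Rightarrow> 'a" +
  assumes clifford: "a \<in> S \<Longrightarrow> f a (inverse_elt S f a) = f (inverse_elt S f a) a"

text \<open>Neither operation is assumed commutative; \<open>add\<close> is written additively below only
  to follow the usual notation for braces.\<close>

locale weak_brace =
  additive: inverse_semigroup S add + multiplicative: inverse_semigroup S circ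
  for S :: "'a set"
    and add :: "'a \<Rightarrow> 'a \<Rightarrow> 'a"  (infixl \<open>\<^bold>+\<close> 65)
    and circ :: "'a \<Rightarrow> 'a \<Rightarrow> 'a"  (infixl \<open>\<^bold>\<circ>\<close> 70) +
  assumes left_brace:
      "\<lbrakk>a \<in> S; b \<in> S; c \<in> S\<rbrakk> \<Longrightarrow>
        a \<^bold>\<circ> (b \<^bold>+ c) = a \<^bold>\<circ> b \<^bold>+ inverse_elt S add a \<^bold>+ a \<^bold>\<circ> c"
    and idempotents_agree:
      "a \<in> S \<Longrightarrow> a \<^bold>\<circ> inverse_elt S circ a = inverse_elt S add a \<^bold>+ a"

locale dual_weak_brace = weak_brace S add circ + clifford_semigroup S circ
  for S :: "'a set" and add :: "'a \<Rightarrow> 'a \<Rightarrow> 'a" and circ :: "'a \<Rightarrow> 'a \<Rightarrow> 'a"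

definition right_distributor ::
    "'a set \<Rightarrow> ('a \<Rightarrow> 'a \<Rightarrow> 'a) \<Rightarrow> ('a \<Rightarrow> 'a \<Rightarrow> 'a) \<Rightarrow> 'a set" where
  "right_distributor S add circ =
    {z \<in> S. \<forall>a\<in>S. \<forall>b\<in>S.
      circ (add a b) z = add (add (circ a z) (inverse_elt S add z)) (circ b z)}"

definition semigroup_center :: "'a set \<Rightarrow> ('a \<Rightarrow> 'a \<Rightarrow> 'a) \<Rightarrow> 'a set" where
  "semigroup_center S f = {z \<in> S. \<forall>a\<in>S. f z a = f a z}"

definition inverse_subsemigroup :: "'a set \<Rightarrow> 'a set \<Rightarrow> ('a \<Rightarrow> 'a \<Rightarrow> 'a) \<Rightarrow> bool" where
  "inverse_subsemigroup T S f \<longleftrightarrow>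
    T \<subseteq> S \<and> (\<forall>a\<in>T. \<forall>b\<in>T. f a b \<in> T) \<and> (\<forall>a\<in>T. inverse_elt S f a \<in> T)"

definition full_inverse_subsemigroup :: "'a set \<Rightarrow> 'a set \<Rightarrow> ('a \<Rightarrow> 'a \<Rightarrow> 'a) \<Rightarrow> bool" where
  "full_inverse_subsemigroup T S f \<longleftrightarrow>
    inverse_subsemigroup T S f \<and> {e \<in> S. f e e = e} \<subseteq> T"

end

theory Submission
  imports Defs
begin

text \<open>
  Idempotents of \<open>(S, +)\<close> and \<open>(S, \<circ>)\<close> coincide, and for an idempotent \<open>e\<close> both
  \<open>e + a\<close> and \<open>a + e\<close> equal \<open>e \<circ> a\<close>; so \<open>(S, +)\<close> is a Clifford semigroup, and
  \<open>0\<^sub>a = -a + a\<close> turns both operations into the sum of idempotents.  Up to these idempotents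
  one computes as in a skew brace: if \<open>w\<close> is a distributor, expanding \<open>(z - z) \<circ> w\<close> gives
  \<open>-w + (-z) \<circ> w - w = -(z \<circ> w)\<close>, which yields closure under products and inverses.
\<close>

section \<open>Inverse and Clifford semigroups: commuting and central idempotents\<close>

context inverse_semigroup
begin

lemma inverse_elt_of_inverse_elt:
  assumes "a \<in> S"
  shows "inverse_elt_of S f a (inverse_elt S f a)"
  unfolding inverse_elt_def by (rule theI') (rule unique_inverse[OF assms])

lemma inverse_elt_closed [simp]: "a \<in> S \<Longrightarrow> inverse_elt S f a \<in> S"
  using inverse_elt_of_inverse_elt unfolding inverse_elt_of_def by blast

lemma mult_inverse_mult: "a \<in> S \<Longrightarrow> f (f a (inverse_elt S f a)) a = a"
  using inverse_elt_of_inverse_elt unfolding inverse_elt_of_def by metis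

lemma inverse_mult_inverse:
  "a \<in> S \<Longrightarrow> f (f (inverse_elt S f a) a) (inverse_elt S f a) = inverse_elt S f a"
  using inverse_elt_of_inverse_elt unfolding inverse_elt_of_def by metis

lemma inverse_elt_eqI:
  assumes "a \<in> S" "b \<in> S" "f (f a b) a = a" "f (f b a) b = b"
  shows "inverse_elt S f a = b"
  using assms unique_inverse[of a] inverse_elt_of_inverse_elt[of a]
  unfolding inverse_elt_of_def by metis

lemma inverse_elt_idempotent:
  "\<lbrakk>e \<in> S; f e e = e\<rbrakk> \<Longrightarrow> inverse_elt S f e = e"
  by (rule inverse_elt_eqI) auto

lemma inverse_elt_inverse_elt [simp]:
  "a \<in> S \<Longrightarrow> inverse_elt S f (inverse_elt S f a) = a"
  by (rule inverse_elt_eqI) (auto simp: mult_inverse_mult inverse_mult_inverse)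

lemma right_idempotent:
  assumes "a \<in> S"
  shows "f (f (inverse_elt S f a) a) (f (inverse_elt S f a) a) = f (inverse_elt S f a) a"
  using assms by (metis assoc closed inverse_elt_closed inverse_mult_inverse)

lemma left_idempotent:
  assumes "a \<in> S"
  shows "f (f a (inverse_elt S f a)) (f a (inverse_elt S f a)) = f a (inverse_elt S f a)"
  using assms right_idempotent[of "inverse_elt S f a"] by simp

text \<open>If \<open>x\<close> is the inverse of \<open>f e g\<close>, then the product of
  \<open>g\<close>, \<open>x\<close>, \<open>e\<close> is also an inverse of \<open>f e g\<close>,
  so it equals \<open>x\<close> by uniqueness. This form makes \<open>x\<close> idempotent, hence
  its own inverse, and therefore equal to \<open>f e g\<close>.\<close>

lemma idempotent_mult_idempotent:
  assumes e: "e \<in> S" "f e e = e" and g: "g \<in> S" "f g g = g"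
  shows "f (f e g) (f e g) = f e g"
proof -
  define x where "x = inverse_elt S f (f e g)"
  have eg: "f e g \<in> S" and x: "x \<in> S"
    using e g by (auto simp: x_def closed)
  note [simp] = closed assoc e g x
  \<comment> \<open>Products are normalised to the right, so idempotency is also needed with a
    trailing factor.\<close>
  have ee: "f e (f e u) = f e u" if "u \<in> S" for u
    using that e assoc[of e e u] by simp
  have gg: "f g (f g u) = f g u" if "u \<in> S" for u
    using that g assoc[of g g u] by simp
  have 1: "f e (f g (f x (f e g))) = f e g"
    using mult_inverse_mult[OF eg] by (simp add: x_def[symmetric])
  have 2: "f x (f e (f g x)) = x"
    using inverse_mult_inverse[OF eg] by (simp add: x_def[symmetric])
  have 3: "f x (f e (f g (f x e))) = f x e"
    using arg_cong[OF 2, of "\<lambda>t. f t e"] by simp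
  have "x = f g (f x e)"
    unfolding x_def
    by (rule inverse_elt_eqI[OF eg]) (use 1 3 in \<open>simp_all add: x_def[symmetric] ee gg\<close>)
  then have "f x x = x"
    using 3 by (metis assoc closed e(1) g(1) x)
  then have "inverse_elt S f x = x"
    using x by (rule inverse_elt_idempotent[rotated])
  then have "f e g = x"
    using eg by (simp add: x_def)
  then show ?thesis using \<open>f x x = x\<close> by simp
qed

text \<open>Both \<open>f e g\<close>, being idempotent, and \<open>f g e\<close> are inverses of
  \<open>f e g\<close>; uniqueness identifies them.\<close>

lemma idempotents_commute:
  assumes e: "e \<in> S" "f e e = e" and g: "g \<in> S" "f g g = g"
  shows "f e g = f g e"
proof -
  note [simp] = closed assoc e g
  have ee: "f e (f e u) = f e u" if "u \<in> S" for u
    using that e assoc[of e e u] by simp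
  have gg: "f g (f g u) = f g u" if "u \<in> S" for u
    using that g assoc[of g g u] by simp
  have 1: "f e (f g (f e g)) = f e g"
    using idempotent_mult_idempotent[OF e g] by simp
  have 2: "f g (f e (f g e)) = f g e"
    using idempotent_mult_idempotent[OF g e] by simp
  have "inverse_elt S f (f e g) = f e g"
    by (rule inverse_elt_idempotent) (use 1 in simp_all)
  moreover have "inverse_elt S f (f e g) = f g e"
    by (rule inverse_elt_eqI) (use 1 2 in \<open>simp_all add: ee gg\<close>)
  ultimately show ?thesis by simp
qed

text \<open>In the middle of the triple products stand the idempotents \<open>f b b'\<close> and
  \<open>f a' a\<close>; swapping them lets each factor meet its own inverse.\<close>

lemma inverse_elt_mult:
  assumes [simp]: "a \<in> S" "b \<in> S"
  shows "inverse_elt S f (f a b) = f (inverse_elt S f b) (inverse_elt S f a)"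
proof -
  define a' b' where "a' = inverse_elt S f a" and "b' = inverse_elt S f b"
  have [simp]: "a' \<in> S" "b' \<in> S" by (simp_all add: a'_def b'_def)
  note [simp] = closed
  have comm: "f (f b b') (f a' a) = f (f a' a) (f b b')"
    by (rule idempotents_commute) (simp_all add: a'_def b'_def right_idempotent left_idempotent)
  have a: "f (f a a') a = a" "f (f a' a) a' = a'" and b: "f (f b b') b = b" "f (f b' b) b' = b'"
    by (simp_all add: a'_def b'_def mult_inverse_mult inverse_mult_inverse)
  have "f (f (f a b) (f b' a')) (f a b) = f (f a (f (f b b') (f a' a))) b"
    by (simp add: assoc)
  also have "\<dots> = f (f (f a a') a) (f (f b b') b)"
    unfolding comm by (simp add: assoc)
  also have "\<dots> = f a b" by (simp only: a b)
  finally have 1: "f (f (f a b) (f b' a')) (f a b) = f a b" .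
  have "f (f (f b' a') (f a b)) (f b' a') = f (f b' (f (f a' a) (f b b'))) a'"
    by (simp add: assoc)
  also have "\<dots> = f (f (f b' b) b') (f (f a' a) a')"
    unfolding comm[symmetric] by (simp add: assoc)
  also have "\<dots> = f b' a'" by (simp only: a b)
  finally have 2: "f (f (f b' a') (f a b)) (f b' a') = f b' a'" .
  show ?thesis
    unfolding a'_def[symmetric] b'_def[symmetric]
    by (rule inverse_elt_eqI) (use 1 2 in simp_all)
qed

end

text \<open>The inverse of \<open>f e a\<close> is \<open>f a' e\<close>, so the Clifford law for
  \<open>f e a\<close> rewrites the conjugate a'ea as aa'e. Multiplying by \<open>a\<close> on the
  left gives ea on one side and ae on the other.\<close>

lemma (in clifford_semigroup) idempotent_central:
  assumes [simp]: "a \<in> S" "e \<in> S" and e: "f e e = e"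
  shows "f e a = f a e"
proof -
  define a' where "a' = inverse_elt S f a"
  have [simp]: "a' \<in> S" by (simp add: a'_def)
  note [simp] = closed
  have a: "f (f a a') a = a" by (simp add: a'_def mult_inverse_mult)
  have cl: "f a a' = f a' a" by (simp add: a'_def clifford)
  have comm: "f e (f a a') = f (f a a') e"
    by (rule idempotents_commute) (simp_all add: a'_def left_idempotent e)
  have "f (f e a) (f a' e) = f (f a' e) (f e a)"
    using clifford[of "f e a"] e by (simp add: inverse_elt_mult inverse_elt_idempotent a'_def)
  then have "f (f e (f a a')) e = f (f a' (f e e)) a"
    by (simp add: assoc)
  then have *: "f (f (f a a') e) e = f (f a' e) a"
    by (simp only: comm e)
  have "f e a = f (f e (f a a')) a"
    using a by (simp add: assoc)
  also have "\<dots> = f a (f (f a' e) a)"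
    unfolding comm by (simp add: assoc)
  also have "\<dots> = f a (f (f (f a' a) e) e)"
    unfolding *[symmetric] cl ..
  also have "\<dots> = f (f (f a a') a) (f e e)"
    by (simp add: assoc)
  also have "\<dots> = f a e" unfolding a e ..
  finally show ?thesis .
qed

section \<open>Weak braces: common idempotents and the additive Clifford law\<close>

context weak_brace
begin

abbreviation neg :: "'a \<Rightarrow> 'a" (\<open>\<^bold>- _\<close> [81] 80)
  where "\<^bold>- a \<equiv> inverse_elt S add a"

abbreviation recip :: "'a \<Rightarrow> 'a"
  where "recip a \<equiv> inverse_elt S circ a"

text \<open>The local zero of \<open>a\<close>, a substitute for the common neutral element of a
  skew brace. By \<open>idempotents_agree\<close> it is also the idempotent a \<circ>
  \<open>recip a\<close>.\<close>

definition zero_at :: "'a \<Rightarrow> 'a" (\<open>\<^bold>0\<^bsub>_\<^esub>\<close>)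
  where "\<^bold>0\<^bsub>a\<^esub> = \<^bold>- a \<^bold>+ a"

declare additive.closed [simp] multiplicative.closed [simp]

lemma zero_at_closed [simp]: "a \<in> S \<Longrightarrow> \<^bold>0\<^bsub>a\<^esub> \<in> S"
  by (simp add: zero_at_def)

lemma circ_recip: "a \<in> S \<Longrightarrow> a \<^bold>\<circ> recip a = \<^bold>0\<^bsub>a\<^esub>"
  by (simp add: zero_at_def idempotents_agree)

lemma zero_at_add_idem: "a \<in> S \<Longrightarrow> \<^bold>0\<^bsub>a\<^esub> \<^bold>+ \<^bold>0\<^bsub>a\<^esub> = \<^bold>0\<^bsub>a\<^esub>"
  by (simp add: zero_at_def additive.right_idempotent)

lemma zero_at_circ_idem: "a \<in> S \<Longrightarrow> \<^bold>0\<^bsub>a\<^esub> \<^bold>\<circ> \<^bold>0\<^bsub>a\<^esub> = \<^bold>0\<^bsub>a\<^esub>"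
  using multiplicative.left_idempotent[of a] by (simp add: circ_recip)

lemma add_zero_at: "a \<in> S \<Longrightarrow> a \<^bold>+ \<^bold>0\<^bsub>a\<^esub> = a"
  using additive.mult_inverse_mult[of a] by (simp add: zero_at_def additive.assoc)

lemma zero_at_circ: "a \<in> S \<Longrightarrow> \<^bold>0\<^bsub>a\<^esub> \<^bold>\<circ> a = a"
  using multiplicative.mult_inverse_mult[of a] by (simp add: circ_recip)

lemma zero_at_idempotent:
  assumes "e \<in> S" "e \<^bold>+ e = e"
  shows "\<^bold>0\<^bsub>e\<^esub> = e"
  using assms by (simp add: zero_at_def additive.inverse_elt_idempotent)

text \<open>An idempotent of either operation is its own inverse there, hence equals its local zero,
  and local zeros are idempotent for both operations.\<close>

lemma circ_idempotent_iff_add_idempotent: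
  assumes "e \<in> S"
  shows "e \<^bold>\<circ> e = e \<longleftrightarrow> e \<^bold>+ e = e"
proof
  assume "e \<^bold>\<circ> e = e"
  then have "\<^bold>0\<^bsub>e\<^esub> = e"
    using assms circ_recip[of e] multiplicative.inverse_elt_idempotent[of e] by simp
  then show "e \<^bold>+ e = e" using zero_at_add_idem[OF assms] by simp
next
  assume "e \<^bold>+ e = e"
  then have "\<^bold>0\<^bsub>e\<^esub> = e" using assms by (rule zero_at_idempotent[rotated])
  then show "e \<^bold>\<circ> e = e" using zero_at_circ_idem[OF assms] by simp
qed

lemma add_idempotent_imp_circ_idempotent: "\<lbrakk>e \<in> S; e \<^bold>+ e = e\<rbrakk> \<Longrightarrow> e \<^bold>\<circ> e = e"
  by (simp add: circ_idempotent_iff_add_idempotent)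

lemma idempotent_circ_distrib:
  assumes "e \<in> S" "e \<^bold>+ e = e" "a \<in> S" "b \<in> S"
  shows "e \<^bold>\<circ> (a \<^bold>+ b) = e \<^bold>\<circ> a \<^bold>+ e \<^bold>+ e \<^bold>\<circ> b"
  using assms by (simp add: left_brace additive.inverse_elt_idempotent)

text \<open>Expanding e \<circ> (g + g) inserts a summand e between two copies of e \<circ> g; these
  are commuting additive idempotents, so the copies merge.\<close>

lemma idempotents_circ_le:
  assumes e: "e \<in> S" "e \<^bold>+ e = e" and g: "g \<in> S" "g \<^bold>+ g = g"
  shows "e \<^bold>\<circ> g \<^bold>+ e = e \<^bold>\<circ> g"
proof -
  note [simp] = e g
  have "(e \<^bold>\<circ> g) \<^bold>\<circ> (e \<^bold>\<circ> g) = e \<^bold>\<circ> g"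
    by (rule multiplicative.idempotent_mult_idempotent)
      (simp_all add: circ_idempotent_iff_add_idempotent)
  then have idem: "e \<^bold>\<circ> g \<^bold>+ e \<^bold>\<circ> g = e \<^bold>\<circ> g"
    by (simp add: circ_idempotent_iff_add_idempotent)
  have comm: "e \<^bold>+ e \<^bold>\<circ> g = e \<^bold>\<circ> g \<^bold>+ e"
    by (rule additive.idempotents_commute) (simp_all add: idem)
  have "e \<^bold>\<circ> g = e \<^bold>\<circ> g \<^bold>+ e \<^bold>+ e \<^bold>\<circ> g"
    using idempotent_circ_distrib[OF e g(1) g(1)] by simp
  also have "\<dots> = (e \<^bold>\<circ> g \<^bold>+ e \<^bold>\<circ> g) \<^bold>+ e"
    by (simp add: additive.assoc comm)
  finally show ?thesis by (simp add: idem)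
qed

text \<open>For h = e + g, the product of h and e is computed twice: expanding h \<circ> (h + e) = h
  gives h = h \<circ> e, and expanding e \<circ> (e + g) gives e \<circ> h = e \<circ> g.\<close>

lemma idempotents_circ_eq_add:
  assumes e: "e \<in> S" "e \<^bold>+ e = e" and g: "g \<in> S" "g \<^bold>+ g = g"
  shows "e \<^bold>\<circ> g = e \<^bold>+ g"
proof -
  note [simp] = e g
  define h where "h = e \<^bold>+ g"
  have [simp]: "h \<in> S" "h \<^bold>+ h = h"
    using additive.idempotent_mult_idempotent[OF e g] by (simp_all add: h_def)
  have "h \<^bold>+ e = h"
    using additive.idempotents_commute[OF g e]
    by (simp add: h_def additive.assoc) (simp add: additive.assoc[symmetric])
  have idem: "h \<^bold>\<circ> e \<^bold>+ h \<^bold>\<circ> e = h \<^bold>\<circ> e"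
    using multiplicative.idempotent_mult_idempotent[of h e]
    by (simp add: circ_idempotent_iff_add_idempotent)
  have "h = h \<^bold>\<circ> (h \<^bold>+ e)"
    unfolding \<open>h \<^bold>+ e = h\<close> by (simp add: add_idempotent_imp_circ_idempotent)
  also have "\<dots> = h \<^bold>+ h \<^bold>\<circ> e"
    by (simp add: idempotent_circ_distrib add_idempotent_imp_circ_idempotent)
  also have "\<dots> = h \<^bold>\<circ> e \<^bold>+ h"
    by (rule additive.idempotents_commute) (simp_all add: idem)
  also have "\<dots> = h \<^bold>\<circ> e" by (rule idempotents_circ_le) simp_all
  also have "\<dots> = e \<^bold>\<circ> h"
    by (rule multiplicative.idempotents_commute)
      (simp_all add: circ_idempotent_iff_add_idempotent)
  also have "\<dots> = e \<^bold>+ e \<^bold>\<circ> g"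
    unfolding h_def
    by (simp add: idempotent_circ_distrib add_idempotent_imp_circ_idempotent)
  also have "\<dots> = e \<^bold>\<circ> g \<^bold>+ e"
    using multiplicative.idempotent_mult_idempotent[of e g]
    by (intro additive.idempotents_commute)
      (simp_all add: circ_idempotent_iff_add_idempotent)
  also have "\<dots> = e \<^bold>\<circ> g" by (rule idempotents_circ_le) simp_all
  finally show ?thesis by (simp add: h_def)
qed

text \<open>Writing a as a + \<open>0\<^sub>a\<close> makes the expansion of e \<circ> a end in a
  sum of idempotents containing e, which absorbs a further e.\<close>

lemma idempotent_circ_add_idempotent:
  assumes e: "e \<in> S" "e \<^bold>+ e = e" and [simp]: "a \<in> S"
  shows "e \<^bold>\<circ> a \<^bold>+ e = e \<^bold>\<circ> a"
proof -
  note [simp] = e zero_at_add_idem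
  have comm: "e \<^bold>+ \<^bold>0\<^bsub>a\<^esub> = \<^bold>0\<^bsub>a\<^esub> \<^bold>+ e"
    by (rule additive.idempotents_commute) simp_all
  have "e \<^bold>\<circ> a = e \<^bold>\<circ> (a \<^bold>+ \<^bold>0\<^bsub>a\<^esub>)" by (simp add: add_zero_at)
  also have "\<dots> = e \<^bold>\<circ> a \<^bold>+ (e \<^bold>+ (e \<^bold>+ \<^bold>0\<^bsub>a\<^esub>))"
    by (simp add: idempotent_circ_distrib idempotents_circ_eq_add additive.assoc)
  also have "\<dots> = e \<^bold>\<circ> a \<^bold>+ (\<^bold>0\<^bsub>a\<^esub> \<^bold>+ e)"
    by (simp add: additive.assoc[symmetric]) (simp add: additive.assoc comm)
  finally have *: "e \<^bold>\<circ> a = e \<^bold>\<circ> a \<^bold>+ (\<^bold>0\<^bsub>a\<^esub> \<^bold>+ e)" .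
  then have "e \<^bold>\<circ> a \<^bold>+ e = e \<^bold>\<circ> a \<^bold>+ (\<^bold>0\<^bsub>a\<^esub> \<^bold>+ e) \<^bold>+ e"
    by (rule arg_cong)
  also have "\<dots> = e \<^bold>\<circ> a \<^bold>+ (\<^bold>0\<^bsub>a\<^esub> \<^bold>+ e)" by (simp add: additive.assoc)
  also have "\<dots> = e \<^bold>\<circ> a" by (rule *[symmetric])
  finally show ?thesis .
qed

text \<open>The mirror image: absorption on the left calls for the left idempotent a - a, which is
  not yet known to equal \<open>0\<^sub>a\<close>.\<close>

lemma idempotent_add_idempotent_circ:
  assumes e: "e \<in> S" "e \<^bold>+ e = e" and [simp]: "a \<in> S"
  shows "e \<^bold>+ e \<^bold>\<circ> a = e \<^bold>\<circ> a"
proof -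
  note [simp] = e
  define h where "h = a \<^bold>+ \<^bold>- a"
  have [simp]: "h \<in> S" "h \<^bold>+ h = h" "h \<^bold>+ a = a"
    by (simp_all add: h_def additive.left_idempotent additive.mult_inverse_mult)
  have "e \<^bold>\<circ> a = e \<^bold>\<circ> (h \<^bold>+ a)" by simp
  also have "\<dots> = e \<^bold>+ h \<^bold>+ e \<^bold>+ e \<^bold>\<circ> a"
    by (subst idempotent_circ_distrib) (simp_all add: idempotents_circ_eq_add)
  finally have *: "e \<^bold>\<circ> a = e \<^bold>+ h \<^bold>+ e \<^bold>+ e \<^bold>\<circ> a" .
  then have "e \<^bold>+ e \<^bold>\<circ> a = e \<^bold>+ (e \<^bold>+ h \<^bold>+ e \<^bold>+ e \<^bold>\<circ> a)" by (rule arg_cong)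
  also have "\<dots> = (e \<^bold>+ e) \<^bold>+ h \<^bold>+ e \<^bold>+ e \<^bold>\<circ> a"
    by (simp add: additive.assoc del: e(2))
  also have "\<dots> = e \<^bold>\<circ> a" unfolding e(2) by (rule *[symmetric])
  finally show ?thesis .
qed

lemma zero_at_add_idempotent:
  assumes e: "e \<in> S" "e \<^bold>+ e = e" and [simp]: "a \<in> S"
  shows "\<^bold>0\<^bsub>a \<^bold>+ e\<^esub> = \<^bold>0\<^bsub>a\<^esub> \<^bold>+ e"
proof -
  note [simp] = e zero_at_add_idem
  have comm: "e \<^bold>+ \<^bold>0\<^bsub>a\<^esub> = \<^bold>0\<^bsub>a\<^esub> \<^bold>+ e"
    by (rule additive.idempotents_commute) simp_all
  have "\<^bold>0\<^bsub>a \<^bold>+ e\<^esub> = (e \<^bold>+ \<^bold>0\<^bsub>a\<^esub>) \<^bold>+ e"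
    by (simp add: zero_at_def additive.inverse_elt_mult additive.inverse_elt_idempotent
        additive.assoc)
  then show ?thesis unfolding comm by (simp add: additive.assoc)
qed

text \<open>The local zero of a + e is k = \<open>0\<^sub>a\<close> + e, so k \<circ> (a + e) = a +
  e. Expanding the left side and absorbing e and k leaves k \<circ> a, where the factor
  \<open>0\<^sub>a\<close> of k disappears into a.\<close>

lemma add_idempotent_eq_circ:
  assumes e: "e \<in> S" "e \<^bold>+ e = e" and [simp]: "a \<in> S"
  shows "a \<^bold>+ e = e \<^bold>\<circ> a"
proof -
  note [simp] = e zero_at_add_idem
  define k where "k = \<^bold>0\<^bsub>a\<^esub> \<^bold>+ e"
  have [simp]: "k \<in> S" "k \<^bold>+ k = k"
    using additive.idempotent_mult_idempotent[of "\<^bold>0\<^bsub>a\<^esub>" e] by (simp_all add: k_def)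
  have ke: "k \<^bold>+ e = k" by (simp add: k_def additive.assoc)
  have "a \<^bold>+ e = k \<^bold>\<circ> (a \<^bold>+ e)"
    using zero_at_circ[of "a \<^bold>+ e"] by (simp add: zero_at_add_idempotent k_def)
  also have "\<dots> = k \<^bold>\<circ> a \<^bold>+ k"
    by (simp add: idempotent_circ_distrib idempotents_circ_eq_add ke additive.assoc)
  also have "\<dots> = k \<^bold>\<circ> a" by (rule idempotent_circ_add_idempotent) simp_all
  also have "\<dots> = (e \<^bold>\<circ> \<^bold>0\<^bsub>a\<^esub>) \<^bold>\<circ> a"
    using additive.idempotents_commute[of e "\<^bold>0\<^bsub>a\<^esub>"]
    by (simp add: k_def idempotents_circ_eq_add)
  also have "\<dots> = e \<^bold>\<circ> a" by (simp add: multiplicative.assoc zero_at_circ)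
  finally show ?thesis .
qed

text \<open>The conjugate \<open>k = -a + e + a\<close> is idempotent, hence commutes with \<open>e\<close>; as
  \<open>e + b + e = b + e\<close> for all \<open>b\<close>, this gives \<open>k = k + e\<close>, and adding \<open>a\<close> on the left
  yields \<open>e + a = e + a + e = a + e\<close>.\<close>

lemma idempotent_add_commute:
  assumes e: "e \<in> S" "e \<^bold>+ e = e" and [simp]: "a \<in> S"
  shows "e \<^bold>+ a = a \<^bold>+ e"
proof -
  note [simp] = e
  have absorb: "e \<^bold>+ b \<^bold>+ e = b \<^bold>+ e" if "b \<in> S" for b
    using that idempotent_add_idempotent_circ[OF e that]
    by (simp add: add_idempotent_eq_circ[symmetric] additive.assoc)
  define n where "n = \<^bold>- a"
  have [simp]: "n \<in> S" by (simp add: n_def)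
  have an: "a \<^bold>+ n \<^bold>+ a = a" "n \<^bold>+ a \<^bold>+ n = n"
    by (simp_all add: n_def additive.mult_inverse_mult additive.inverse_mult_inverse)
  have comm: "e \<^bold>+ (a \<^bold>+ n) = (a \<^bold>+ n) \<^bold>+ e"
    by (rule additive.idempotents_commute) (simp_all add: n_def additive.left_idempotent)
  have k: "(n \<^bold>+ e \<^bold>+ a) \<^bold>+ (n \<^bold>+ e \<^bold>+ a) = n \<^bold>+ e \<^bold>+ a"
  proof -
    have "(n \<^bold>+ e \<^bold>+ a) \<^bold>+ (n \<^bold>+ e \<^bold>+ a) = n \<^bold>+ (e \<^bold>+ (a \<^bold>+ n)) \<^bold>+ e \<^bold>+ a"
      by (simp add: additive.assoc)
    also have "\<dots> = (n \<^bold>+ a \<^bold>+ n) \<^bold>+ (e \<^bold>+ e) \<^bold>+ a"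
      unfolding comm by (simp add: additive.assoc del: e(2))
    finally show ?thesis by (simp add: an)
  qed
  have "e \<^bold>+ (n \<^bold>+ e \<^bold>+ a) = (n \<^bold>+ e \<^bold>+ a) \<^bold>+ e"
    by (rule additive.idempotents_commute) (simp_all add: k)
  then have "n \<^bold>+ e \<^bold>+ a = (n \<^bold>+ e \<^bold>+ a) \<^bold>+ e"
    using absorb[of n] by (simp add: additive.assoc) (simp add: additive.assoc[symmetric])
  then have "a \<^bold>+ (n \<^bold>+ e \<^bold>+ a) = a \<^bold>+ ((n \<^bold>+ e \<^bold>+ a) \<^bold>+ e)" by simp
  then have "(a \<^bold>+ n) \<^bold>+ e \<^bold>+ a = (a \<^bold>+ n) \<^bold>+ e \<^bold>+ (a \<^bold>+ e)" by (simp add: additive.assoc)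
  then have "e \<^bold>+ (a \<^bold>+ n \<^bold>+ a) = e \<^bold>+ (a \<^bold>+ n \<^bold>+ a) \<^bold>+ e"
    unfolding comm[symmetric] by (simp add: additive.assoc)
  then show ?thesis by (simp add: an absorb)
qed

lemma idempotent_circ_eq_add:
  "\<lbrakk>e \<in> S; e \<^bold>+ e = e; a \<in> S\<rbrakk> \<Longrightarrow> e \<^bold>\<circ> a = e \<^bold>+ a"
  by (simp add: idempotent_add_commute[of e a] add_idempotent_eq_circ)

lemma zero_at_add_commute: "\<lbrakk>a \<in> S; b \<in> S\<rbrakk> \<Longrightarrow> \<^bold>0\<^bsub>a\<^esub> \<^bold>+ b = b \<^bold>+ \<^bold>0\<^bsub>a\<^esub>"
  by (rule idempotent_add_commute) (simp_all add: zero_at_add_idem)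

lemma zero_at_add: "a \<in> S \<Longrightarrow> \<^bold>0\<^bsub>a\<^esub> \<^bold>+ a = a"
  by (simp add: zero_at_add_commute add_zero_at)

text \<open>The Clifford law for \<open>add\<close>. The sum -a + a + a - a collapses to a - a
  directly, and to -a + a once the idempotent a - a is moved past a.\<close>

lemma add_neg:
  assumes [simp]: "a \<in> S"
  shows "a \<^bold>+ \<^bold>- a = \<^bold>0\<^bsub>a\<^esub>"
proof -
  have comm: "(a \<^bold>+ \<^bold>- a) \<^bold>+ a = a \<^bold>+ (a \<^bold>+ \<^bold>- a)"
    by (rule idempotent_add_commute) (simp_all add: additive.left_idempotent)
  have "a \<^bold>+ \<^bold>- a = (\<^bold>0\<^bsub>a\<^esub> \<^bold>+ a) \<^bold>+ \<^bold>- a" by (simp add: zero_at_add)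
  also have "\<dots> = \<^bold>- a \<^bold>+ a \<^bold>+ (a \<^bold>+ \<^bold>- a)" by (simp add: zero_at_def additive.assoc)
  also have "\<dots> = \<^bold>- a \<^bold>+ ((a \<^bold>+ \<^bold>- a) \<^bold>+ a)"
    unfolding comm by (simp add: additive.assoc)
  also have "\<dots> = \<^bold>0\<^bsub>a\<^esub>" by (simp add: additive.mult_inverse_mult zero_at_def)
  finally show ?thesis .
qed

lemma zero_at_neg: "a \<in> S \<Longrightarrow> \<^bold>0\<^bsub>\<^bold>- a\<^esub> = \<^bold>0\<^bsub>a\<^esub>"
  using add_neg[of a] by (simp add: zero_at_def)

end

section \<open>Dual weak braces: calculus of local zeros\<close>

context dual_weak_brace
begin

notation add (infixl \<open>\<^bold>+\<close> 65)
notation circ (infixl \<open>\<^bold>\<circ>\<close> 70)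

lemma zero_at_circ_commute: "\<lbrakk>a \<in> S; b \<in> S\<rbrakk> \<Longrightarrow> \<^bold>0\<^bsub>a\<^esub> \<^bold>\<circ> b = b \<^bold>\<circ> \<^bold>0\<^bsub>a\<^esub>"
  by (rule idempotent_central) (simp_all add: zero_at_circ_idem)

lemma circ_zero_at: "\<lbrakk>a \<in> S; b \<in> S\<rbrakk> \<Longrightarrow> a \<^bold>\<circ> \<^bold>0\<^bsub>b\<^esub> = a \<^bold>+ \<^bold>0\<^bsub>b\<^esub>"
  by (simp add: zero_at_circ_commute[of b a, symmetric] add_idempotent_eq_circ zero_at_add_idem)

lemma recip_circ: "a \<in> S \<Longrightarrow> recip a \<^bold>\<circ> a = \<^bold>0\<^bsub>a\<^esub>"
  using clifford[of a] by (simp add: circ_recip)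

lemma zero_at_recip: "a \<in> S \<Longrightarrow> \<^bold>0\<^bsub>recip a\<^esub> = \<^bold>0\<^bsub>a\<^esub>"
  using circ_recip[of "recip a"] by (simp add: recip_circ)

text \<open>In (a \<circ> b) \<circ> \<open>recip (a \<circ> b)\<close> the inner factor b \<circ>
  \<open>recip b\<close> is a central idempotent and can be pulled out.\<close>

lemma zero_at_circ_distrib:
  assumes [simp]: "a \<in> S" "b \<in> S"
  shows "\<^bold>0\<^bsub>a \<^bold>\<circ> b\<^esub> = \<^bold>0\<^bsub>a\<^esub> \<^bold>+ \<^bold>0\<^bsub>b\<^esub>"
proof -
  have "\<^bold>0\<^bsub>a \<^bold>\<circ> b\<^esub> = a \<^bold>\<circ> (b \<^bold>\<circ> recip b) \<^bold>\<circ> recip a"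
    by (simp add: circ_recip[symmetric] multiplicative.inverse_elt_mult multiplicative.assoc)
  also have "\<dots> = (\<^bold>0\<^bsub>b\<^esub> \<^bold>\<circ> a) \<^bold>\<circ> recip a"
    by (simp add: circ_recip zero_at_circ_commute[of b a])
  also have "\<dots> = \<^bold>0\<^bsub>b\<^esub> \<^bold>+ \<^bold>0\<^bsub>a\<^esub>"
    by (simp add: circ_recip circ_zero_at multiplicative.assoc)
  also have "\<dots> = \<^bold>0\<^bsub>a\<^esub> \<^bold>+ \<^bold>0\<^bsub>b\<^esub>" by (simp add: zero_at_add_commute[of b "\<^bold>0\<^bsub>a\<^esub>"])
  finally show ?thesis .
qed

section \<open>Closure properties of the distributor\<close>

abbreviation distributor :: "'a set"
  where "distributor \<equiv> right_distributor S add circ"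

lemma distributor_subset: "distributor \<subseteq> S"
  unfolding right_distributor_def by blast

lemma distributor_distrib:
  "\<lbrakk>z \<in> distributor; a \<in> S; b \<in> S\<rbrakk> \<Longrightarrow>
    (a \<^bold>+ b) \<^bold>\<circ> z = a \<^bold>\<circ> z \<^bold>+ \<^bold>- z \<^bold>+ b \<^bold>\<circ> z"
  unfolding right_distributor_def by blast

lemma distributor_neg_circ:
  assumes w: "w \<in> distributor" and [simp]: "z \<in> S"
  shows "\<^bold>- w \<^bold>+ (\<^bold>- z) \<^bold>\<circ> w \<^bold>+ \<^bold>- w = \<^bold>- (z \<^bold>\<circ> w)"
proof -
  have [simp]: "w \<in> S" using w distributor_subset by blast
  \<comment> \<open>This replaces left cancellation of z \<circ> w: the local zero that cancellation
    leaves behind is already absorbed by (-z) \<circ> w.\<close>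
  have "\<^bold>0\<^bsub>(\<^bold>- z) \<^bold>\<circ> w\<^esub> = \<^bold>0\<^bsub>z \<^bold>\<circ> w\<^esub>"
    by (simp add: zero_at_circ_distrib zero_at_neg)
  then have "\<^bold>- w \<^bold>+ (\<^bold>- z) \<^bold>\<circ> w = \<^bold>- w \<^bold>+ (\<^bold>0\<^bsub>z \<^bold>\<circ> w\<^esub> \<^bold>+ (\<^bold>- z) \<^bold>\<circ> w)"
    using zero_at_add[of "(\<^bold>- z) \<^bold>\<circ> w"] by simp
  also have "\<dots> = \<^bold>0\<^bsub>z \<^bold>\<circ> w\<^esub> \<^bold>+ (\<^bold>- w \<^bold>+ (\<^bold>- z) \<^bold>\<circ> w)"
    using zero_at_add_commute[of "z \<^bold>\<circ> w" "\<^bold>- w"] by (simp add: additive.assoc[symmetric])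
  also have "\<dots> = \<^bold>- (z \<^bold>\<circ> w) \<^bold>+ (z \<^bold>\<circ> w \<^bold>+ \<^bold>- w \<^bold>+ (\<^bold>- z) \<^bold>\<circ> w)"
    by (simp add: zero_at_def additive.assoc)
  also have "\<dots> = \<^bold>- (z \<^bold>\<circ> w) \<^bold>+ (z \<^bold>+ \<^bold>- z) \<^bold>\<circ> w"
    using w by (simp add: distributor_distrib)
  also have "\<dots> = \<^bold>- (z \<^bold>\<circ> w) \<^bold>+ (\<^bold>0\<^bsub>z\<^esub> \<^bold>+ w)"
    by (simp add: add_neg idempotent_circ_eq_add zero_at_add_idem)
  \<comment> \<open>Adding -w on the right turns w into \<open>0\<^sub>w\<close>; the resulting sum
    of local zeros is the local zero of z \<circ> w.\<close>
  finally have "\<^bold>- w \<^bold>+ (\<^bold>- z) \<^bold>\<circ> w \<^bold>+ \<^bold>- w = \<^bold>- (z \<^bold>\<circ> w) \<^bold>+ (\<^bold>0\<^bsub>z\<^esub> \<^bold>+ \<^bold>0\<^bsub>w\<^esub>)"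
    by (simp add: additive.assoc add_neg)
  also have "\<dots> = \<^bold>- (z \<^bold>\<circ> w)"
    using add_zero_at[of "\<^bold>- (z \<^bold>\<circ> w)"] by (simp add: zero_at_neg zero_at_circ_distrib)
  finally show ?thesis .
qed

text \<open>Two uses of the distributor law surround (-z) \<circ> w by copies of -w, exactly the sum
  evaluated in \<open>distributor_neg_circ\<close>. The shape x - z + y is the one produced by
  distributing over a further element, as closure under \<circ> requires.\<close>

lemma distributor_distrib_sub:
  assumes w: "w \<in> distributor" and [simp]: "z \<in> S" "x \<in> S" "y \<in> S"
  shows "(x \<^bold>+ \<^bold>- z \<^bold>+ y) \<^bold>\<circ> w = x \<^bold>\<circ> w \<^bold>+ \<^bold>- (z \<^bold>\<circ> w) \<^bold>+ y \<^bold>\<circ> w"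
proof -
  have [simp]: "w \<in> S" using w distributor_subset by blast
  have "(x \<^bold>+ \<^bold>- z \<^bold>+ y) \<^bold>\<circ> w
      = x \<^bold>\<circ> w \<^bold>+ (\<^bold>- w \<^bold>+ (\<^bold>- z) \<^bold>\<circ> w \<^bold>+ \<^bold>- w) \<^bold>+ y \<^bold>\<circ> w"
    using w by (simp add: distributor_distrib) (simp add: additive.assoc)
  then show ?thesis using w by (simp add: distributor_neg_circ)
qed

lemma distributor_circ_closed:
  assumes z: "z \<in> distributor" and w: "w \<in> distributor"
  shows "z \<^bold>\<circ> w \<in> distributor"
proof -
  have [simp]: "z \<in> S" "w \<in> S" using z w distributor_subset by blast+
  have "(a \<^bold>+ b) \<^bold>\<circ> (z \<^bold>\<circ> w) = a \<^bold>\<circ> (z \<^bold>\<circ> w) \<^bold>+ \<^bold>- (z \<^bold>\<circ> w) \<^bold>+ b \<^bold>\<circ> (z \<^bold>\<circ> w)"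
    if [simp]: "a \<in> S" "b \<in> S" for a b
    using z w
    by (simp add: multiplicative.assoc[symmetric] distributor_distrib[OF z] distributor_distrib_sub)
  then show ?thesis unfolding right_distributor_def by simp
qed

text \<open>With w = \<open>recip z\<close>, the two sides of the law for w agree after right
  multiplication by z. Multiplying back by w recovers both sides, since each absorbs
  \<open>0\<^sub>z\<close>.\<close>

lemma distributor_recip_closed:
  assumes z: "z \<in> distributor"
  shows "recip z \<in> distributor"
proof -
  have [simp]: "z \<in> S" using z distributor_subset by blast
  define w where "w = recip z"
  have [simp]: "w \<in> S" by (simp add: w_def)
  have wz: "w \<^bold>\<circ> z = \<^bold>0\<^bsub>z\<^esub>" and zw: "z \<^bold>\<circ> w = \<^bold>0\<^bsub>z\<^esub>" and w0: "\<^bold>0\<^bsub>w\<^esub> = \<^bold>0\<^bsub>z\<^esub>"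
    by (simp_all add: w_def recip_circ circ_recip zero_at_recip)
  have "(a \<^bold>+ b) \<^bold>\<circ> w = a \<^bold>\<circ> w \<^bold>+ \<^bold>- w \<^bold>+ b \<^bold>\<circ> w"
    if [simp]: "a \<in> S" "b \<in> S" for a b
  proof -
    let ?t = "a \<^bold>\<circ> w \<^bold>+ \<^bold>- w \<^bold>+ b \<^bold>\<circ> w"
    \<comment> \<open>Through its last summand, \<open>?t\<close> absorbs the local zero shared by z
      and w.\<close>
    have bw: "b \<^bold>\<circ> w \<^bold>+ \<^bold>0\<^bsub>z\<^esub> = b \<^bold>\<circ> w"
      unfolding circ_zero_at[symmetric, of "b \<^bold>\<circ> w" z, simplified]
      using zero_at_circ_commute[of w w] zero_at_circ[of w]
      by (simp add: multiplicative.assoc w0)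
    have "?t \<^bold>\<circ> z = (a \<^bold>\<circ> w) \<^bold>\<circ> z \<^bold>+ \<^bold>- \<^bold>0\<^bsub>z\<^esub> \<^bold>+ (b \<^bold>\<circ> w) \<^bold>\<circ> z"
      using z by (simp add: distributor_distrib_sub wz)
    also have "\<dots> = (a \<^bold>+ \<^bold>0\<^bsub>z\<^esub>) \<^bold>+ \<^bold>0\<^bsub>z\<^esub> \<^bold>+ (b \<^bold>+ \<^bold>0\<^bsub>z\<^esub>)"
      by (simp add: multiplicative.assoc wz circ_zero_at
          additive.inverse_elt_idempotent zero_at_add_idem)
    also have "\<dots> = a \<^bold>+ ((\<^bold>0\<^bsub>z\<^esub> \<^bold>+ \<^bold>0\<^bsub>z\<^esub>) \<^bold>+ b) \<^bold>+ \<^bold>0\<^bsub>z\<^esub>"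
      by (simp add: additive.assoc)
    also have "\<dots> = (a \<^bold>+ b) \<^bold>+ (\<^bold>0\<^bsub>z\<^esub> \<^bold>+ \<^bold>0\<^bsub>z\<^esub>)"
      by (simp add: zero_at_add_idem zero_at_add_commute[of z b] additive.assoc)
    also have "\<dots> = (a \<^bold>+ b) \<^bold>\<circ> \<^bold>0\<^bsub>z\<^esub>" by (simp add: zero_at_add_idem circ_zero_at)
    finally have *: "?t \<^bold>\<circ> z = (a \<^bold>+ b) \<^bold>\<circ> \<^bold>0\<^bsub>z\<^esub>" .
    have "?t = ?t \<^bold>+ \<^bold>0\<^bsub>z\<^esub>" by (simp add: additive.assoc bw)
    also have "\<dots> = ?t \<^bold>\<circ> z \<^bold>\<circ> w" by (simp add: multiplicative.assoc zw circ_zero_at)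
    also have "\<dots> = (a \<^bold>+ b) \<^bold>\<circ> (\<^bold>0\<^bsub>w\<^esub> \<^bold>\<circ> w)"
      unfolding * by (simp add: multiplicative.assoc w0)
    also have "\<dots> = (a \<^bold>+ b) \<^bold>\<circ> w" by (simp add: zero_at_circ)
    finally show ?thesis ..
  qed
  then show ?thesis unfolding right_distributor_def w_def by simp
qed

text \<open>Idempotents of the Clifford semigroup are central, so the left brace law can be read
  with the factor on the right.\<close>

lemma idempotent_in_distributor:
  assumes [simp]: "e \<in> S" and "e \<^bold>\<circ> e = e"
  shows "e \<in> distributor"
proof -
  have e: "e \<^bold>+ e = e" using assms by (simp add: circ_idempotent_iff_add_idempotent)
  have ce: "c \<^bold>\<circ> e = e \<^bold>\<circ> c" if "c \<in> S" for c
    using that assms by (intro idempotent_central[symmetric])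
  have "(a \<^bold>+ b) \<^bold>\<circ> e = a \<^bold>\<circ> e \<^bold>+ \<^bold>- e \<^bold>+ b \<^bold>\<circ> e" if "a \<in> S" "b \<in> S" for a b
    using that by (simp add: ce left_brace)
  then show ?thesis unfolding right_distributor_def by simp
qed

text \<open>For a central z the distributor law is the left brace law with z moved to the other
  side.\<close>

lemma center_subset_distributor: "semigroup_center S circ \<subseteq> distributor"
proof
  fix z
  assume "z \<in> semigroup_center S circ"
  then have z: "z \<in> S" and central: "\<And>c. c \<in> S \<Longrightarrow> c \<^bold>\<circ> z = z \<^bold>\<circ> c"
    unfolding semigroup_center_def by simp_all
  have "(a \<^bold>+ b) \<^bold>\<circ> z = a \<^bold>\<circ> z \<^bold>+ \<^bold>- z \<^bold>+ b \<^bold>\<circ> z" if "a \<in> S" "b \<in> S" for a b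
    using that z by (simp add: central left_brace)
  with z show "z \<in> distributor" unfolding right_distributor_def by blast
qed

lemma full_inverse_subsemigroup_distributor:
  "full_inverse_subsemigroup distributor S circ"
  unfolding full_inverse_subsemigroup_def inverse_subsemigroup_def
  using distributor_subset distributor_circ_closed distributor_recip_closed
    idempotent_in_distributor by blast

end

theorem proposition3p1:
  fixes S :: "'a set" and add circ :: "'a \<Rightarrow> 'a \<Rightarrow> 'a"
  assumes "dual_weak_brace S add circ"
  shows "full_inverse_subsemigroup (right_distributor S add circ) S circ
    \<and> semigroup_center S circ \<subseteq> right_distributor S add circ"
  using assms dual_weak_brace.full_inverse_subsemigroup_distributor
    dual_weak_brace.center_subset_distributor by blast

end
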